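(* Let $2\le k\le4$, $\alpha\ge3$ and $\mathbf{u}^0\in\mathcal{A}$ be fixed. There is a constant $C>0$, independent of $s$ and $N$, such that for every $s>0$, the sequence $\{\mathbf{u}^n\}_{n\in\mathbb{N}}$ generated with step size $s$ by the BDF-$k$ accelerated gradient algorithm described in the context satisfies, for every integer $N\ge1$, $$\|B(\mathbf{u}^N,\mathbf{u}^N)-\mathbf{u}_c\|_Z\le C\,s^2 .$$
   Context: Setting. $\Omega\subset\mathbb{R}^d$ is a bounded Lipschitz domain; $U$ is a real Hilbert space of functions $\Omega\to\mathbb{R}^m$ continuously embedded in $H^1(\Omega;\mathbb{R}^m)$; $U_D\subset U$ is the set of functions satisfying given Dirichlet conditions on $\Gamma_D\subset\partial\Omega$ and $U_0\subset U$ is the closed linear subspace of functions satisfying the corresponding homogeneous conditions. $Z$ is a normed function space on $\Omega$, $B:U\times U\to Z$ is symmetric bilinear with $\|B(\mathbf{v},\mathbf{v})\|_Z\le c_Z\|\mathbf{v}\|_U^2$, and $\mathbf{u}_c\in Z$. $\mathcal{M}:U\times U\to\mathbb{R}$ is symmetric bilinear with $\mathcal{M}(\mathbf{v},\mathbf{v})\ge C_1\|\mathbf{v}\|_U^2$ and $\mathcal{M}(\mathbf{v},\mathbf{w})\le C_2\|\mathbf{v}\|_U\|\mathbf{w}\|_U$ on $U$ ($C_1,C_2>0$). $\mathcal{A}=\{\mathbf{u}\in U_D:B(\mathbf{u},\mathbf{u})=\mathbf{u}_c\}$ and $\mathcal{F}_{\mathbf{u}}=\{\mathbf{v}\in U_0:B(\mathbf{u},\mathbf{v})=0\}$.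 BDF-$k$ formulas. $\delta_0=\sum_{r=1}^k\frac1r$, $\delta_i=\frac{(-1)^i}{i}\binom{k}{i}$ ($1\le i\le k$), $\gamma_j=(-1)^j\binom{k}{j+1}$ and $\tilde\delta_j=\sum_{\ell=0}^j\delta_\ell$ ($0\le j\le k-1$); $$\dot{\mathbf{u}}^n=\frac1s\sum_{j=0}^k\delta_j\mathbf{u}^{n-j},\quad\hat{\mathbf{u}}^n=\sum_{j=0}^{k-1}\gamma_j\mathbf{u}^{n-j-1},\quad\widetilde{\mathbf{u}}^n=\sum_{j=0}^{k-1}\tilde\delta_j\mathbf{u}^{n-j},$$ with the convention $\mathbf{u}^{-1}:=\mathbf{u}^0$ (zero initial velocity). Algorithm (infinite sequence, no stopping). Given $\alpha\ge3$, $s>0$, $t_n=ns$, $\mathbf{u}^0\in\mathcal{A}$. The BDF-$k$ step at index $n$ determines $\mathbf{u}^n$ from $\mathbf{u}^{n-1},\dots,\mathbf{u}^{n-k-1}$ by requiring $\dot{\mathbf{u}}^n\in\mathcal{F}_{\hat{\mathbf{u}}^n}$ and $$\Big(\tfrac{\dot{\mathbf{u}}^n-\dot{\mathbf{u}}^{n-1}}{s},\mathbf{w}\Big)_U+\tfrac{\alpha}{t_n}(\dot{\mathbf{u}}^n,\mathbf{w})_U+\mathcal{M}(\widetilde{\mathbf{u}}^n,\mathbf{w})=0\quad\text{for all }\mathbf{w}\in\mathcal{F}_{\hat{\mathbf{u}}^n},$$ all quantities being given by the BDF-$k$ formulas. The initial values $\mathbf{u}^1,\dots,\mathbf{u}^{k-1}$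 are computed successively by the BDF-$p$ step at index $n=p$ (same equations with $k$ replaced by $p$), $p=1,\dots,k-1$; for $n\ge k$ the BDF-$k$ step is used. *)

theory Defs
  imports "HOL-Analysis.Analysis"
begin

text \<open>
  Near every boundary point the domain is the strict epigraph, in some unit direction
  \<^term>\<open>\<nu>\<close>, of a Lipschitz function \<^term>\<open>h\<close> on the hyperplane orthogonal to
  \<^term>\<open>\<nu>\<close>.
\<close>

definition bounded_lipschitz_domain :: "(real^'d) set \<Rightarrow> bool" where
  "bounded_lipschitz_domain \<Omega> \<longleftrightarrow>
     open \<Omega> \<and> connected \<Omega> \<and> \<Omega> \<noteq> {} \<and> bounded \<Omega> \<and>
     (\<forall>x\<in>frontier \<Omega>. \<exists>\<nu> h L r.
        norm \<nu> = 1 \<and> r > 0 \<and> L-lipschitz_on {z. z \<bullet> \<nu> = 0} h \<and>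
        \<Omega> \<inter> ball x r = {y \<in> ball x r. y \<bullet> \<nu> > h (y - (y \<bullet> \<nu>) *\<^sub>R \<nu>)})"

text \<open>
  \<^term>\<open>D \<beta>\<close> is the iterated partial derivative of \<^term>\<open>\<phi>\<close> along the list of
  directions \<^term>\<open>\<beta>\<close>.
\<close>

definition C_infinity :: "(real^'d \<Rightarrow> real) \<Rightarrow> bool" where
  "C_infinity \<phi> \<longleftrightarrow>
     (\<exists>D :: 'd list \<Rightarrow> real^'d \<Rightarrow> real. D [] = \<phi> \<and>
        (\<forall>\<beta> x. (D \<beta> has_derivative (\<lambda>h. \<Sum>i\<in>UNIV. D (i # \<beta>) x * h $ i)) (at x)))"

definition test_function :: "(real^'d) set \<Rightarrow> (real^'d \<Rightarrow> real) \<Rightarrow> bool" where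
  "test_function \<Omega> \<phi> \<longleftrightarrow>
     C_infinity \<phi> \<and> compact (closure {x. \<phi> x \<noteq> 0}) \<and> closure {x. \<phi> x \<noteq> 0} \<subseteq> \<Omega>"

definition L2_on :: "(real^'d) set \<Rightarrow> (real^'d \<Rightarrow> real^'m) \<Rightarrow> bool" where
  "L2_on \<Omega> f \<longleftrightarrow>
     set_borel_measurable lebesgue \<Omega> f \<and> set_integrable lebesgue \<Omega> (\<lambda>x. (norm (f x))\<^sup>2)"

definition has_weak_partial ::
    "(real^'d) set \<Rightarrow> 'd \<Rightarrow> (real^'d \<Rightarrow> real^'m) \<Rightarrow> (real^'d \<Rightarrow> real^'m) \<Rightarrow> bool" where
  "has_weak_partial \<Omega> i f g \<longleftrightarrow>
     (\<forall>\<phi>. test_function \<Omega> \<phi> \<longrightarrow>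
        (LINT x:\<Omega>|lebesgue. frechet_derivative \<phi> (at x) (axis i 1) *\<^sub>R f x) =
        - (LINT x:\<Omega>|lebesgue. \<phi> x *\<^sub>R g x))"

definition H1 :: "(real^'d) set \<Rightarrow> (real^'d \<Rightarrow> real^'m) set" where
  "H1 \<Omega> = {f. L2_on \<Omega> f \<and> (\<forall>i. \<exists>g. L2_on \<Omega> g \<and> has_weak_partial \<Omega> i f g)}"

text \<open>Weak derivatives are unique up to null sets, so the choice does not affect the norm.\<close>

definition weak_partial ::
    "(real^'d) set \<Rightarrow> 'd \<Rightarrow> (real^'d \<Rightarrow> real^'m) \<Rightarrow> real^'d \<Rightarrow> real^'m" where
  "weak_partial \<Omega> i f = (SOME g. L2_on \<Omega> g \<and> has_weak_partial \<Omega> i f g)"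

definition H1_norm :: "(real^'d) set \<Rightarrow> (real^'d \<Rightarrow> real^'m) \<Rightarrow> real" where
  "H1_norm \<Omega> f =
     sqrt ((LINT x:\<Omega>|lebesgue. (norm (f x))\<^sup>2) +
           (\<Sum>i\<in>UNIV. LINT x:\<Omega>|lebesgue. (norm (weak_partial \<Omega> i f x))\<^sup>2))"

text \<open>
  A space of functions on \<^term>\<open>\<Omega>\<close> modulo null sets is modelled by a type together with a map
  \<^term>\<open>\<iota>\<close> that selects a representative of each element.
\<close>

definition function_space_on ::
    "(real^'d) set \<Rightarrow> ('a::real_vector \<Rightarrow> real^'d \<Rightarrow> 'b::real_vector) \<Rightarrow> bool" where
  "function_space_on \<Omega> \<iota> \<longleftrightarrow>
     (\<forall>v w. AE x in lebesgue. x \<in> \<Omega> \<longrightarrow> \<iota> (v + w) x = \<iota> v x + \<iota> w x) \<and>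
     (\<forall>c v. AE x in lebesgue. x \<in> \<Omega> \<longrightarrow> \<iota> (c *\<^sub>R v) x = c *\<^sub>R \<iota> v x) \<and>
     (\<forall>v w. (AE x in lebesgue. x \<in> \<Omega> \<longrightarrow> \<iota> v x = \<iota> w x) \<longrightarrow> v = w)"

definition continuously_embedded_in_H1 ::
    "(real^'d) set \<Rightarrow> ('u::real_normed_vector \<Rightarrow> real^'d \<Rightarrow> real^'m) \<Rightarrow> bool" where
  "continuously_embedded_in_H1 \<Omega> \<iota> \<longleftrightarrow>
     (\<forall>v. \<iota> v \<in> H1 \<Omega>) \<and> (\<exists>c. \<forall>v. H1_norm \<Omega> (\<iota> v) \<le> c * norm v)"

text \<open>
  A Dirichlet condition on \<^term>\<open>\<Gamma>\<close> prescribes the value of a bounded linear trace operator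
  \<^term>\<open>\<tau>\<close>, whose kernel contains every function vanishing near \<^term>\<open>\<Gamma>\<close>. The order of the
  trace is left open: besides the boundary values of $v$ it may collect those of derivatives
  (clamped conditions) or of some components of $v$ only.
\<close>

definition trace_operator ::
    "(real^'d) set \<Rightarrow> (real^'d) set \<Rightarrow> ('u::real_normed_vector \<Rightarrow> real^'d \<Rightarrow> real^'m) \<Rightarrow>
     ('u \<Rightarrow> 'y::real_normed_vector) \<Rightarrow> bool" where
  "trace_operator \<Omega> \<Gamma> \<iota> \<tau> \<longleftrightarrow>
     bounded_linear \<tau> \<and>
     (\<forall>v W. open W \<and> \<Gamma> \<subseteq> W \<and> (AE x in lebesgue. x \<in> \<Omega> \<inter> W \<longrightarrow> \<iota> v x = 0) \<longrightarrow> \<tau> v = 0)"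

definition dirichlet_set :: "('u \<Rightarrow> 'y) \<Rightarrow> 'y \<Rightarrow> 'u set" where
  "dirichlet_set \<tau> g = {v. \<tau> v = g}"

definition symmetric_form :: "('u \<Rightarrow> 'u \<Rightarrow> 'b) \<Rightarrow> bool" where
  "symmetric_form b \<longleftrightarrow> (\<forall>v w. b v w = b w v)"

definition admissible_set :: "'u set \<Rightarrow> ('u \<Rightarrow> 'u \<Rightarrow> 'z) \<Rightarrow> 'z \<Rightarrow> 'u set" where
  "admissible_set U\<^sub>D B u\<^sub>c = {v \<in> U\<^sub>D. B v v = u\<^sub>c}"

definition tangent_space :: "'u set \<Rightarrow> ('u \<Rightarrow> 'u \<Rightarrow> 'z::zero) \<Rightarrow> 'u \<Rightarrow> 'u set" where
  "tangent_space U\<^sub>0 B v = {w \<in> U\<^sub>0. B v w = 0}"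

definition bdf_delta :: "nat \<Rightarrow> nat \<Rightarrow> real" where
  "bdf_delta k i =
     (if i = 0 then (\<Sum>r=1..k. 1 / real r) else (-1) ^ i / real i * real (k choose i))"

definition bdf_gamma :: "nat \<Rightarrow> nat \<Rightarrow> real" where
  "bdf_gamma k j = (-1) ^ j * real (k choose (j + 1))"

definition bdf_delta_tilde :: "nat \<Rightarrow> nat \<Rightarrow> real" where
  "bdf_delta_tilde k j = (\<Sum>l=0..j. bdf_delta k l)"

text \<open>
  Truncated subtraction on \<^typ>\<open>nat\<close> implements the convention $u^{-1} = u^0$: all indices
  occurring in the steps of the algorithm are at least $-1$, and $-1$ is sent to $0$.
\<close>

definition bdf_dot :: "nat \<Rightarrow> real \<Rightarrow> (nat \<Rightarrow> 'u::real_vector) \<Rightarrow> nat \<Rightarrow> 'u" where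
  "bdf_dot k s u n = (1 / s) *\<^sub>R (\<Sum>j=0..k. bdf_delta k j *\<^sub>R u (n - j))"

definition bdf_hat :: "nat \<Rightarrow> (nat \<Rightarrow> 'u::real_vector) \<Rightarrow> nat \<Rightarrow> 'u" where
  "bdf_hat k u n = (\<Sum>j=0..<k. bdf_gamma k j *\<^sub>R u (n - j - 1))"

definition bdf_tilde :: "nat \<Rightarrow> (nat \<Rightarrow> 'u::real_vector) \<Rightarrow> nat \<Rightarrow> 'u" where
  "bdf_tilde k u n = (\<Sum>j=0..<k. bdf_delta_tilde k j *\<^sub>R u (n - j))"

text \<open>
  In the step below \<^term>\<open>F v\<close> is the space of admissible variations at \<^term>\<open>v\<close> and
  \<^term>\<open>real n * s\<close> is the time $t_n$.
\<close>

definition bdf_step ::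
    "nat \<Rightarrow> real \<Rightarrow> real \<Rightarrow> ('u \<Rightarrow> 'u \<Rightarrow> real) \<Rightarrow> ('u \<Rightarrow> 'u set) \<Rightarrow>
     (nat \<Rightarrow> 'u::real_inner) \<Rightarrow> nat \<Rightarrow> bool" where
  "bdf_step k \<alpha> s M F u n \<longleftrightarrow>
     bdf_dot k s u n \<in> F (bdf_hat k u n) \<and>
     (\<forall>w \<in> F (bdf_hat k u n).
        ((1 / s) *\<^sub>R (bdf_dot k s u n - bdf_dot k s u (n - 1))) \<bullet> w
        + \<alpha> / (real n * s) * (bdf_dot k s u n \<bullet> w)
        + M (bdf_tilde k u n) w = 0)"

definition bdf_accelerated_sequence ::
    "nat \<Rightarrow> real \<Rightarrow> real \<Rightarrow> ('u \<Rightarrow> 'u \<Rightarrow> real) \<Rightarrow> ('u \<Rightarrow> 'u set) \<Rightarrow> 'u \<Rightarrow>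
     (nat \<Rightarrow> 'u::real_inner) \<Rightarrow> bool" where
  "bdf_accelerated_sequence k \<alpha> s M F u\<^sub>0 u \<longleftrightarrow>
     u 0 = u\<^sub>0 \<and>
     (\<forall>p. 1 \<le> p \<and> p \<le> k - 1 \<longrightarrow> bdf_step p \<alpha> s M F u p) \<and>
     (\<forall>n\<ge>k. bdf_step k \<alpha> s M F u n)"

end

(*
  Write D u n = u n - u (n - 1).  The BDF quotient satisfies s * dot u = tilde (D u) = D (tilde u),
  so testing each step with dot u itself shows that |dot u|^2 + M (tilde u, tilde u) decreases
  and that its decrements dominate |D (dot u)|^2.  The polynomial of the coefficients of tilde is
  zero-stable, so tilde can be inverted in l^2 and in the supremum norm.  Hence the squares of the
  second differences W = D (D u) sum up to O(s^2).

  As the coefficients delta_j add up to zero, expanding B (u (n - j), u (n - j)) around the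
  extrapolation hat u turns the orthogonality B (hat u, dot u) = 0 into
    tilde (D b) n = sum_j delta_j B (e_j, e_j),   b n = B (u n, u n),  e_j = u (n - j) - hat u n.
  For k = 2, 3, 4 all terms containing the first difference D u (n - 1) cancel on the right,
  which leaves a quadratic form in W n, W (n - 1), W (n - 2).  Summing over n bounds
  tilde (b - u_c) by O(s^2), and inverting tilde bounds b - u_c.
*)

theory Submission
  imports Defs
begin

subsection \<open>BDF coefficients\<close>

text \<open>Truncated subtraction makes the value at 0 vanish, which is the zero initial velocity
  encoded by u^{-1} = u^0.\<close>

definition bdiff :: "(nat \<Rightarrow> 'a::ab_group_add) \<Rightarrow> nat \<Rightarrow> 'a" where
  "bdiff x n = x n - x (n - 1)"

text \<open>Induction on k by Pascal's rule. By the absorption identity j * (k+1 choose j) = (k+1) *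
  (k choose (j-1)), the new summand is 1/(k+1) times an alternating binomial sum. This identity is
  what makes \<open>bdf_delta k 0\<close> cancel the other coefficients.\<close>

lemma sum_alternating_binomial_over:
  "(\<Sum>j=1..k. (-1) ^ j / real j * real (k choose j)) = - (\<Sum>r=1..k. 1 / real r)"
proof (induction k)
  case (Suc k)
  have abs: "1 / real j * real (k choose (j - 1)) = 1 / real (Suc k) * real (Suc k choose j)"
    if "1 \<le> j" for j
  proof -
    have "j * (Suc k choose j) = Suc k * (k choose (j - 1))"
      using that Suc_times_binomial_eq[of k "j - 1"] by (simp add: mult.commute)
    then have "real j * real (Suc k choose j) = real (Suc k) * real (k choose (j - 1))"
      by (metis of_nat_mult)
    with that show ?thesis
      by (simp add: field_simps del: binomial_Suc_Suc)
  qed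
  \<comment> \<open>The full alternating sum is 0, and its missing term j = 0 equals 1.\<close>
  have alt: "(\<Sum>j=1..Suc k. (-1) ^ j * real (Suc k choose j)) = -1"
    using choose_alternating_sum[of "Suc k", where ?'a = real]
    by (simp add: atMost_atLeast0 sum.atLeast_Suc_atMost[of 0] del: binomial_Suc_Suc)
  have "(\<Sum>j=1..Suc k. (-1) ^ j / real j * real (Suc k choose j)) =
      (\<Sum>j=1..Suc k. (-1) ^ j / real j * real (k choose j)) +
      (\<Sum>j=1..Suc k. (-1) ^ j / real j * real (k choose (j - 1)))"
    unfolding sum.distrib[symmetric]
    by (rule sum.cong) (auto simp: choose_reduce_nat algebra_simps add_divide_distrib)
  also have "(\<Sum>j=1..Suc k. (-1) ^ j / real j * real (k choose (j - 1))) =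
      (\<Sum>j=1..Suc k. 1 / real (Suc k) * ((-1) ^ j * real (Suc k choose j)))"
  proof (rule sum.cong)
    fix j assume "j \<in> {1..Suc k}"
    then have "1 / real j * real (k choose (j - 1)) = 1 / real (Suc k) * real (Suc k choose j)"
      by (intro abs) simp
    then have "(-1) ^ j * (1 / real j * real (k choose (j - 1))) =
        (-1) ^ j * (1 / real (Suc k) * real (Suc k choose j))" by simp
    then show "(-1) ^ j / real j * real (k choose (j - 1)) =
        1 / real (Suc k) * ((-1) ^ j * real (Suc k choose j))"
      by (simp add: mult_ac del: binomial_Suc_Suc)
  qed simp
  also have "\<dots> = 1 / real (Suc k) * (\<Sum>j=1..Suc k. (-1) ^ j * real (Suc k choose j))"
    by (rule sum_distrib_left[symmetric])
  finally show ?case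
    using Suc.IH alt by (simp del: binomial_Suc_Suc)
qed simp

lemma sum_bdf_delta: "(\<Sum>j=0..k. bdf_delta k j) = 0"
  using sum_alternating_binomial_over[of k]
  by (simp add: bdf_delta_def sum.atLeast_Suc_atMost[of 0])

text \<open>The extrapolation reproduces constants: an alternating binomial sum again, without its
  zeroth term and with reversed sign.\<close>

lemma sum_bdf_gamma:
  assumes "k \<ge> 1"
  shows "(\<Sum>j=0..<k. bdf_gamma k j) = 1"
proof -
  have "(\<Sum>i=0..k. (-1) ^ i * real (k choose i)) = 0"
    using choose_alternating_sum[of k, where ?'a = real] assms by (simp add: atMost_atLeast0)
  then have "(\<Sum>i=Suc 0..<Suc k. (-1) ^ i * real (k choose i)) = -1"
    by (simp add: sum.atLeast_Suc_atMost[of 0] atLeastLessThanSuc_atLeastAtMost)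
  then have "(\<Sum>i=0..<k. - ((-1) ^ i * real (k choose Suc i))) = -1"
    by (simp only: sum.shift_bounds_Suc_ivl) simp
  then show ?thesis
    by (simp add: bdf_gamma_def sum_negf)
qed

lemma bdf_delta_tilde_last: "bdf_delta_tilde k k = 0"
  by (simp add: bdf_delta_tilde_def sum_bdf_delta)

lemma bdf_delta_tilde_first: "k \<ge> 1 \<Longrightarrow> bdf_delta_tilde k 0 \<ge> 1"
  by (simp add: bdf_delta_tilde_def bdf_delta_def sum.atLeast_Suc_atMost[of "Suc 0"] sum_nonneg)

text \<open>Summation by parts. The boundary term carries the sum of all delta_j, which is
  0.\<close>

lemma sum_bdf_delta_scaleR:
  fixes x :: "nat \<Rightarrow> 'a::real_vector"
  shows "(\<Sum>j=0..k. bdf_delta k j *\<^sub>R x j)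
    = (\<Sum>j=0..<k. bdf_delta_tilde k j *\<^sub>R (x j - x (Suc j)))"
proof -
  have "(\<Sum>j=0..m. bdf_delta k j *\<^sub>R x j)
      = (\<Sum>j=0..<m. bdf_delta_tilde k j *\<^sub>R (x j - x (Suc j))) + bdf_delta_tilde k m *\<^sub>R x m" for m
    by (induction m) (auto simp: bdf_delta_tilde_def algebra_simps)
  from this[of k] show ?thesis
    by (simp add: bdf_delta_tilde_last)
qed

lemma bdf_tilde_bdiff: "bdf_tilde k (bdiff x) n = bdiff (bdf_tilde k x) n"
  by (simp add: bdf_tilde_def bdiff_def sum_subtractf[symmetric] scaleR_diff_right[symmetric]
      diff_commute)

lemma bdf_dot_eq: "bdf_dot k s x n = (1 / s) *\<^sub>R bdf_tilde k (bdiff x) n"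
  unfolding bdf_dot_def sum_bdf_delta_scaleR[of k "\<lambda>j. x (n - j)"]
  by (simp add: bdf_tilde_def bdiff_def)

lemma norm_bdf_tilde_le:
  fixes x :: "nat \<Rightarrow> 'a::real_normed_vector"
  assumes "\<And>i. i \<le> n \<Longrightarrow> norm (x i) \<le> K"
  shows "norm (bdf_tilde k x n) \<le> (\<Sum>j=0..<k. \<bar>bdf_delta_tilde k j\<bar>) * K"
  unfolding bdf_tilde_def sum_distrib_right
  by (rule sum_norm_le) (simp add: assms mult_left_mono)

text \<open>The leading coefficient is at least 1, so solving \<open>bdf_tilde k x n\<close> for the
  newest entry enlarges nothing. Unlike the stability lemmas for orders 2 to 4, this covers every
  order of the starting procedure, but its constant may grow with each application.\<close>

lemma norm_le_bdf_tilde: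
  fixes x :: "nat \<Rightarrow> 'a::real_normed_vector"
  assumes "k \<ge> 1" "n \<ge> 1" "\<And>i. i < n \<Longrightarrow> norm (x i) \<le> K"
  shows "norm (x n) \<le> norm (bdf_tilde k x n) + (\<Sum>j=0..<k. \<bar>bdf_delta_tilde k j\<bar>) * K"
proof -
  have "0 \<le> K"
    using assms(2) assms(3)[of 0] norm_ge_zero[of "x 0"] by linarith
  have eq: "bdf_tilde k x n = bdf_delta_tilde k 0 *\<^sub>R x n
      + (\<Sum>j=1..<k. bdf_delta_tilde k j *\<^sub>R x (n - j))"
    using assms(1) by (simp add: bdf_tilde_def sum.atLeast_Suc_lessThan[of 0])
  have "norm (\<Sum>j=1..<k. bdf_delta_tilde k j *\<^sub>R x (n - j)) \<le> (\<Sum>j=1..<k. \<bar>bdf_delta_tilde k j\<bar>) * K"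
    unfolding sum_distrib_right
    by (rule sum_norm_le) (use assms in \<open>simp add: mult_left_mono\<close>)
  also have "\<dots> \<le> (\<Sum>j=0..<k. \<bar>bdf_delta_tilde k j\<bar>) * K"
    using \<open>0 \<le> K\<close> by (intro mult_right_mono sum_mono2) auto
  finally have rest: "norm (\<Sum>j=1..<k. bdf_delta_tilde k j *\<^sub>R x (n - j))
      \<le> (\<Sum>j=0..<k. \<bar>bdf_delta_tilde k j\<bar>) * K" .
  have "norm (x n) \<le> norm (bdf_delta_tilde k 0 *\<^sub>R x n)"
    using bdf_delta_tilde_first[OF assms(1)] mult_right_mono[of 1 "\<bar>bdf_delta_tilde k 0\<bar>" "norm (x n)"] by simp
  also have "\<dots> = norm (bdf_tilde k x n - (\<Sum>j=1..<k. bdf_delta_tilde k j *\<^sub>R x (n - j)))"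
    by (simp add: eq)
  also have "\<dots> \<le> norm (bdf_tilde k x n) + norm (\<Sum>j=1..<k. bdf_delta_tilde k j *\<^sub>R x (n - j))"
    by (rule norm_triangle_ineq4)
  finally show ?thesis using rest by linarith
qed

section \<open>Explicit form of the tilde operator for orders 2, 3, 4\<close>

lemma bdf_cases:
  assumes "2 \<le> k" "k \<le> (4::nat)"
  obtains "k = 2" | "k = 3" | "k = 4"
  using assms by linarith

lemma bdf_tilde_2: "bdf_tilde 2 x n = (3/2) *\<^sub>R x n - (1/2) *\<^sub>R x (n - 1)"
  by (simp add: bdf_tilde_def bdf_delta_tilde_def bdf_delta_def numeral_eq_Suc)

lemma bdf_tilde_3: "bdf_tilde 3 x n = (11/6) *\<^sub>R x n - (7/6) *\<^sub>R x (n - 1) + (1/3) *\<^sub>R x (n - 2)"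
  by (simp add: bdf_tilde_def bdf_delta_tilde_def bdf_delta_def numeral_eq_Suc)

lemma bdf_tilde_4: "bdf_tilde 4 x n = (25/12) *\<^sub>R x n - (23/12) *\<^sub>R x (n - 1)
   + (13/12) *\<^sub>R x (n - 2) - (1/4) *\<^sub>R x (n - 3)"
  by (simp add: bdf_tilde_def bdf_delta_tilde_def bdf_delta_def numeral_eq_Suc)


subsection \<open>Stability\<close>

text \<open>
  For k = 4 the recursion for \<^term>\<open>x n\<close> itself is not an l1-contraction (its coefficients are
  23/25, -13/25, 3/25); substituting it once for \<^term>\<open>x (n - 1)\<close> makes it one.
\<close>

lemma bdf_tilde_recursion:
  assumes "2 \<le> k" "k \<le> 4"
  obtains a :: "nat \<Rightarrow> real"
  where "\<And>i. 0 \<le> a i" "(\<Sum>i=1..k. a i) \<le> 9/11"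
    "\<And>(x :: nat \<Rightarrow> 'a::real_normed_vector) n. k \<le> n \<Longrightarrow>
      norm (x n) \<le> (\<Sum>i=1..k. a i * norm (x (n - i)))
        + norm (bdf_tilde k x n) + norm (bdf_tilde k x (n - 1))"
  using assms
proof (cases k rule: bdf_cases)
  case 1
  let ?a = "\<lambda>i::nat. if i = 1 then 1/3 else 0 :: real"
  have "norm (x n) \<le> (\<Sum>i=1..k. ?a i * norm (x (n - i)))
        + norm (bdf_tilde k x n) + norm (bdf_tilde k x (n - 1))" if "k \<le> n"
    for x :: "nat \<Rightarrow> 'a" and n
  proof -
    let ?y = "bdf_tilde 2 x n"
    have "norm (x n) = norm ((1/3) *\<^sub>R x (n - 1) + (2/3) *\<^sub>R ?y)"
      unfolding bdf_tilde_2 by (rule arg_cong[where f = norm]) norm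
    also have "\<dots> \<le> 1/3 * norm (x (n - 1)) + 2/3 * norm ?y"
      by (intro norm_triangle_mono) simp_all
    finally have "norm (x n) \<le> 1/3 * norm (x (n - 1)) + 2/3 * norm ?y" .
    moreover have "(\<Sum>i=1..2. ?a i * norm (x (n - i))) = 1/3 * norm (x (n - 1))"
      by (simp add: numeral_eq_Suc)
    ultimately show ?thesis
      using norm_ge_zero[of "bdf_tilde 2 x n"] norm_ge_zero[of "bdf_tilde 2 x (n - 1)"]
      unfolding 1 by argo
  qed
  with 1 show ?thesis
    by (intro that[of ?a]) (auto simp: numeral_eq_Suc)
next
  case 2
  \<comment> \<open>Order 3 fixes the common bound, 7/11 + 2/11 = 9/11. Order 2 gives 1/3, and order
    4 gives 497/625, which is smaller than 9/11.\<close>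
  let ?a = "\<lambda>i::nat. if i = 1 then 7/11 else if i = 2 then 2/11 else 0 :: real"
  have "norm (x n) \<le> (\<Sum>i=1..k. ?a i * norm (x (n - i)))
        + norm (bdf_tilde k x n) + norm (bdf_tilde k x (n - 1))" if "k \<le> n"
    for x :: "nat \<Rightarrow> 'a" and n
  proof -
    let ?y = "bdf_tilde 3 x n"
    have "norm (x n) = norm ((7/11) *\<^sub>R x (n - 1) + (-2/11) *\<^sub>R x (n - 2) + (6/11) *\<^sub>R ?y)"
      unfolding bdf_tilde_3 by (rule arg_cong[where f = norm]) norm
    also have "\<dots> \<le> 7/11 * norm (x (n - 1)) + 2/11 * norm (x (n - 2)) + 6/11 * norm ?y"
      by (intro norm_triangle_mono) simp_all
    finally have "norm (x n) \<le> 7/11 * norm (x (n - 1)) + 2/11 * norm (x (n - 2)) + 6/11 * norm ?y" .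
    moreover have "(\<Sum>i=1..3. ?a i * norm (x (n - i))) =
        7/11 * norm (x (n - 1)) + 2/11 * norm (x (n - 2))"
      by (simp add: numeral_eq_Suc)
    ultimately show ?thesis
      using norm_ge_zero[of "bdf_tilde 3 x n"] norm_ge_zero[of "bdf_tilde 3 x (n - 1)"]
      unfolding 2 by argo
  qed
  with 2 show ?thesis
    by (intro that[of ?a]) (auto simp: numeral_eq_Suc)
next
  case 3
  let ?a = "\<lambda>i::nat. if i = 2 then 204/625 else if i = 3 then 224/625
    else if i = 4 then 69/625 else 0 :: real"
  have "norm (x n) \<le> (\<Sum>i=1..k. ?a i * norm (x (n - i)))
        + norm (bdf_tilde k x n) + norm (bdf_tilde k x (n - 1))" if "k \<le> n"
    for x :: "nat \<Rightarrow> 'a" and n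
  proof -
    let ?y = "bdf_tilde 4 x n" and ?z = "bdf_tilde 4 x (n - 1)"
    have idx: "n - 1 - 1 = n - 2" "n - 1 - 2 = n - 3" "n - 1 - 3 = n - 4"
      by simp_all
    have "norm (x n) = norm ((204/625) *\<^sub>R x (n - 2) + (-224/625) *\<^sub>R x (n - 3) + (69/625) *\<^sub>R x (n - 4)
        + (12/25) *\<^sub>R ?y + (276/625) *\<^sub>R ?z)"
      unfolding bdf_tilde_4 idx by (rule arg_cong[where f = norm]) norm
    also have "\<dots> \<le> 204/625 * norm (x (n - 2)) + 224/625 * norm (x (n - 3))
        + 69/625 * norm (x (n - 4)) + 12/25 * norm ?y + 276/625 * norm ?z"
      by (intro norm_triangle_mono) simp_all
    finally have "norm (x n) \<le> 204/625 * norm (x (n - 2)) + 224/625 * norm (x (n - 3))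
        + 69/625 * norm (x (n - 4)) + 12/25 * norm ?y + 276/625 * norm ?z" .
    moreover have "(\<Sum>i=1..4. ?a i * norm (x (n - i))) =
        204/625 * norm (x (n - 2)) + 224/625 * norm (x (n - 3)) + 69/625 * norm (x (n - 4))"
      by (simp add: numeral_eq_Suc)
    ultimately show ?thesis
      using norm_ge_zero[of "bdf_tilde 4 x n"] norm_ge_zero[of "bdf_tilde 4 x (n - 1)"]
      unfolding 3 by argo
  qed
  with 3 show ?thesis
    by (intro that[of ?a]) (auto simp: numeral_eq_Suc)
qed

text \<open>Strong induction with the contraction factor 9/11. The recursion adds at most
  \<open>2 * Y\<close>, and 9/11 * 11 + 2 = 11 explains the constant. The recursion at index k
  already looks at the tilde value at k - 1, hence the range of the hypothesis.\<close>

lemma bdf_tilde_sup_stability: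
  fixes x :: "nat \<Rightarrow> 'a::real_normed_vector"
  assumes k: "2 \<le> k" "k \<le> 4"
    and init: "\<And>i. i < k \<Longrightarrow> norm (x i) \<le> K"
    and tilde: "\<And>n. k - 1 \<le> n \<Longrightarrow> norm (bdf_tilde k x n) \<le> Y"
  shows "norm (x n) \<le> K + 11 * Y"
proof -
  obtain a :: "nat \<Rightarrow> real" where a: "\<And>i. 0 \<le> a i" "(\<Sum>i=1..k. a i) \<le> 9/11"
    and rec: "\<And>(x :: nat \<Rightarrow> 'a) n. k \<le> n \<Longrightarrow>
      norm (x n) \<le> (\<Sum>i=1..k. a i * norm (x (n - i)))
        + norm (bdf_tilde k x n) + norm (bdf_tilde k x (n - 1))"
    using bdf_tilde_recursion[OF k, where ?'a = 'a] by blast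
  have "0 \<le> Y"
    using tilde[of k] norm_ge_zero[of "bdf_tilde k x k"] by linarith
  have "0 \<le> K"
    using k init[of 0] norm_ge_zero[of "x 0"] by linarith
  show ?thesis
  proof (induction n rule: less_induct)
    case (less n)
    show ?case
    proof (cases "n < k")
      case True
      then show ?thesis using init[of n] \<open>0 \<le> Y\<close> by linarith
    next
      case False
      have "norm (x n) \<le> (\<Sum>i=1..k. a i * norm (x (n - i))) + Y + Y" (is "_ \<le> ?R + Y + Y")
        using rec[of n x] tilde[of n] tilde[of "n - 1"] False by fastforce
      have "(\<Sum>i=1..k. a i * norm (x (n - i))) \<le> (\<Sum>i=1..k. a i * (K + 11 * Y))"
        using False k by (intro sum_mono mult_left_mono less.IH a) auto
      also have "\<dots> = (\<Sum>i=1..k. a i) * (K + 11 * Y)"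
        by (simp add: sum_distrib_right)
      also have "\<dots> \<le> 9/11 * (K + 11 * Y)"
        using \<open>0 \<le> K\<close> \<open>0 \<le> Y\<close> by (intro mult_right_mono a) auto
      finally have "(\<Sum>i=1..k. a i * norm (x (n - i))) \<le> 9/11 * (K + 11 * Y)" .
      with \<open>norm (x n) \<le> ?R + Y + Y\<close> show ?thesis using \<open>0 \<le> K\<close> by argo
    qed
  qed
qed

section \<open>Square-summable inversion of the tilde operator\<close>

lemma sum_shift_le:
  fixes f :: "nat \<Rightarrow> real"
  assumes "\<And>n. 0 \<le> f n" "i \<le> k"
  shows "(\<Sum>n=k..N. f (n - i)) \<le> (\<Sum>n=k-i..N. f n)"
proof -
  have "(\<Sum>n=k..N. f (n - i)) = sum f ((\<lambda>n. n - i) ` {k..N})"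
    using assms(2) by (intro sum.reindex_cong[symmetric]) (auto simp: inj_on_def)
  also have "\<dots> \<le> (\<Sum>n=k-i..N. f n)"
    using assms by (intro sum_mono2) auto
  finally show ?thesis .
qed

text \<open>A Jensen inequality in which the missing weight, at least 2/11, absorbs the perturbation
  z at the price 1/(2/11) = 11/2. The proof adds the weighted squared deviations from the value m
  itself to a completed square in m and z.\<close>

lemma convex_combination_square_le:
  fixes a y :: "'i \<Rightarrow> real"
  assumes "finite I" "\<And>i. 0 \<le> a i" "(\<Sum>i\<in>I. a i) \<le> 9/11"
  shows "((\<Sum>i\<in>I. a i * y i) + z)\<^sup>2 \<le> (\<Sum>i\<in>I. a i * (y i)\<^sup>2) + 11/2 * z\<^sup>2"
proof -
  define A where "A = (\<Sum>i\<in>I. a i)"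
  define m where "m = (\<Sum>i\<in>I. a i * y i) + z"
  have A: "A \<le> 9/11" using assms by (simp add: A_def)
  have "0 \<le> (\<Sum>i\<in>I. a i * (y i - m)\<^sup>2)"
    using assms by (intro sum_nonneg) auto
  also have "\<dots> = (\<Sum>i\<in>I. a i * (y i)\<^sup>2 - 2 * m * (a i * y i) + m\<^sup>2 * a i)"
    by (intro sum.cong) (auto simp: power2_eq_square algebra_simps)
  also have "\<dots> = (\<Sum>i\<in>I. a i * (y i)\<^sup>2) - 2 * m * (m - z) + m\<^sup>2 * A"
    by (simp add: sum.distrib sum_subtractf sum_distrib_left[symmetric] m_def A_def)
  finally have "2 * m * (m - z) - m\<^sup>2 * A \<le> (\<Sum>i\<in>I. a i * (y i)\<^sup>2)" by simp
  moreover have "m\<^sup>2 * A \<le> m\<^sup>2 * (9/11)" using A by (intro mult_left_mono) auto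
  moreover have "0 \<le> 2/11 * (m - 11/2 * z)\<^sup>2" by simp
  ultimately show ?thesis
    unfolding m_def[symmetric] by (simp add: power2_eq_square algebra_simps)
qed

text \<open>Squaring the recursion and summing over n bounds the sum by 9/11 of itself, plus the
  initial squares, plus 22 times the tilde squares. Absorbing the first term multiplies the rest by
  11/2, which gives 11/2 and 121.\<close>

lemma bdf_tilde_l2_stability:
  fixes x :: "nat \<Rightarrow> 'a::real_normed_vector"
  assumes k: "2 \<le> k" "k \<le> 4"
  shows "(\<Sum>n=0..N. (norm (x n))\<^sup>2)
    \<le> 11/2 * (\<Sum>n<k. (norm (x n))\<^sup>2) + 121 * (\<Sum>n=k-1..N. (norm (bdf_tilde k x n))\<^sup>2)"
proof -
  obtain a :: "nat \<Rightarrow> real" where a: "\<And>i. 0 \<le> a i" "(\<Sum>i=1..k. a i) \<le> 9/11"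
    and rec: "\<And>(x :: nat \<Rightarrow> 'a) n. k \<le> n \<Longrightarrow>
      norm (x n) \<le> (\<Sum>i=1..k. a i * norm (x (n - i)))
        + norm (bdf_tilde k x n) + norm (bdf_tilde k x (n - 1))"
    using bdf_tilde_recursion[OF k, where ?'a = 'a] by blast
  let ?y = "\<lambda>n. norm (bdf_tilde k x n)"
  let ?S = "\<Sum>n=0..N. (norm (x n))\<^sup>2" and ?Y = "\<Sum>n=k-1..N. (?y n)\<^sup>2"
  have step: "(norm (x n))\<^sup>2 \<le> (\<Sum>i=1..k. a i * (norm (x (n - i)))\<^sup>2)
      + 11 * ((?y n)\<^sup>2 + (?y (n - 1))\<^sup>2)" if "k \<le> n" for n
  proof -
    have "(norm (x n))\<^sup>2 \<le> ((\<Sum>i=1..k. a i * norm (x (n - i))) + (?y n + ?y (n - 1)))\<^sup>2"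
      using rec[OF that, of x] by (intro power_mono) (auto simp: add.assoc)
    also have "\<dots> \<le> (\<Sum>i=1..k. a i * (norm (x (n - i)))\<^sup>2) + 11/2 * (?y n + ?y (n - 1))\<^sup>2"
      by (rule convex_combination_square_le) (use a in auto)
    finally have "(norm (x n))\<^sup>2 \<le> (\<Sum>i=1..k. a i * (norm (x (n - i)))\<^sup>2)
        + 11/2 * (?y n + ?y (n - 1))\<^sup>2" .
    moreover have "(?y n + ?y (n - 1))\<^sup>2 \<le> 2 * ((?y n)\<^sup>2 + (?y (n - 1))\<^sup>2)"
      using sum_squares_bound[of "?y n" "?y (n - 1)"] by (simp add: power2_sum)
    ultimately show ?thesis by argo
  qed
  have Y1: "(\<Sum>n=k..N. (?y n)\<^sup>2) \<le> ?Y"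
    by (intro sum_mono2) auto
  have Y2: "(\<Sum>n=k..N. (?y (n - 1))\<^sup>2) \<le> ?Y"
    using k by (intro sum_shift_le) auto
  \<comment> \<open>After exchanging the sums, each shifted inner sum is dominated by the full sum,
    so only the total weight of the a_i matters.\<close>
  have "(\<Sum>n=k..N. \<Sum>i=1..k. a i * (norm (x (n - i)))\<^sup>2)
      = (\<Sum>i=1..k. a i * (\<Sum>n=k..N. (norm (x (n - i)))\<^sup>2))"
    by (subst sum.swap) (simp add: sum_distrib_left)
  also have "\<dots> \<le> (\<Sum>i=1..k. a i * ?S)"
  proof (intro sum_mono mult_left_mono a)
    fix i assume "i \<in> {1..k}"
    then have "(\<Sum>n=k..N. (norm (x (n - i)))\<^sup>2) \<le> (\<Sum>n=k-i..N. (norm (x n))\<^sup>2)"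
      by (intro sum_shift_le) auto
    also have "\<dots> \<le> ?S" by (intro sum_mono2) auto
    finally show "(\<Sum>n=k..N. (norm (x (n - i)))\<^sup>2) \<le> ?S" .
  qed
  also have "\<dots> = (\<Sum>i=1..k. a i) * ?S"
    by (simp add: sum_distrib_right)
  also have "\<dots> \<le> 9/11 * ?S"
    by (intro mult_right_mono a sum_nonneg) auto
  finally have conv: "(\<Sum>n=k..N. \<Sum>i=1..k. a i * (norm (x (n - i)))\<^sup>2) \<le> 9/11 * ?S" .
  have "?S \<le> (\<Sum>n\<in>{..<k} \<union> {k..N}. (norm (x n))\<^sup>2)"
    by (intro sum_mono2) auto
  also have "\<dots> = (\<Sum>n<k. (norm (x n))\<^sup>2) + (\<Sum>n=k..N. (norm (x n))\<^sup>2)"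
    by (intro sum.union_disjoint) auto
  finally have split: "?S \<le> (\<Sum>n<k. (norm (x n))\<^sup>2) + (\<Sum>n=k..N. (norm (x n))\<^sup>2)" .
  have "(\<Sum>n=k..N. (norm (x n))\<^sup>2) \<le> (\<Sum>n=k..N. (\<Sum>i=1..k. a i * (norm (x (n - i)))\<^sup>2)
      + 11 * ((?y n)\<^sup>2 + (?y (n - 1))\<^sup>2))"
    by (intro sum_mono step) auto
  also have "\<dots> = (\<Sum>n=k..N. \<Sum>i=1..k. a i * (norm (x (n - i)))\<^sup>2)
      + 11 * ((\<Sum>n=k..N. (?y n)\<^sup>2) + (\<Sum>n=k..N. (?y (n - 1))\<^sup>2))"
    by (simp add: sum.distrib sum_distrib_left)
  finally show ?thesis using split conv Y1 Y2 by argo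
qed

subsection \<open>The constraint along the iteration\<close>

definition bdf_remainder ::
    "nat \<Rightarrow> ('u::real_vector \<Rightarrow> 'u \<Rightarrow> 'z::real_vector) \<Rightarrow> (nat \<Rightarrow> 'u) \<Rightarrow> nat \<Rightarrow> 'z" where
  "bdf_remainder k B u n =
     (\<Sum>j=0..k. bdf_delta k j *\<^sub>R B (u (n - j) - bdf_hat k u n) (u (n - j) - bdf_hat k u n))"

lemma bilinear_diff_square:
  assumes "bilinear B" "symmetric_form B"
  shows "B (x - y) (x - y) = B x x - 2 *\<^sub>R B y x + B y y"
proof -
  have "B x y = B y x" using assms(2) by (simp add: symmetric_form_def)
  then show ?thesis
    by (simp add: bilinear_lsub[OF assms(1)] bilinear_rsub[OF assms(1)] scaleR_2)
qed

text \<open>Expansion of each square around the extrapolation: the constant part drops out because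
  the delta_j add up to 0, and the linear part is a multiple of B (hat u, dot u), which is
  0.\<close>

lemma bdf_tilde_bdiff_square:
  assumes "bilinear B" "symmetric_form B" "s \<noteq> 0"
    and "B (bdf_hat k u n) (bdf_dot k s u n) = 0"
  shows "bdf_tilde k (bdiff (\<lambda>i. B (u i) (u i))) n = bdf_remainder k B u n"
proof -
  let ?h = "bdf_hat k u n"
  have lin: "linear (B ?h)" using assms(1) by (simp add: bilinear_def)
  have "B ?h (bdf_dot k s u n) = (1 / s) *\<^sub>R (\<Sum>j=0..k. bdf_delta k j *\<^sub>R B ?h (u (n - j)))"
    unfolding bdf_dot_def by (simp add: linear_cmul[OF lin] linear_sum[OF lin] o_def)
  with assms have orth: "(\<Sum>j=0..k. bdf_delta k j *\<^sub>R B ?h (u (n - j))) = 0" by simp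
  have "bdf_remainder k B u n = (\<Sum>j=0..k. bdf_delta k j *\<^sub>R B (u (n - j)) (u (n - j))
      - 2 *\<^sub>R (bdf_delta k j *\<^sub>R B ?h (u (n - j))) + bdf_delta k j *\<^sub>R B ?h ?h)"
    unfolding bdf_remainder_def
    by (simp add: bilinear_diff_square[OF assms(1,2)] scaleR_add_right scaleR_diff_right mult.commute)
  also have "\<dots> = (\<Sum>j=0..k. bdf_delta k j *\<^sub>R B (u (n - j)) (u (n - j)))
      - 2 *\<^sub>R (\<Sum>j=0..k. bdf_delta k j *\<^sub>R B ?h (u (n - j))) + (\<Sum>j=0..k. bdf_delta k j) *\<^sub>R B ?h ?h"
    by (simp only: sum.distrib sum_subtractf scaleR_sum_right scaleR_sum_left)
  also have "\<dots> = (\<Sum>j=0..k. bdf_delta k j *\<^sub>R B (u (n - j)) (u (n - j)))"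
    by (simp add: orth sum_bdf_delta)
  \<comment> \<open>With step size 1, \<open>bdf_dot_eq\<close> is summation by parts for the
    sequence of constraint values.\<close>
  also have "\<dots> = bdf_tilde k (bdiff (\<lambda>i. B (u i) (u i))) n"
    using bdf_dot_eq[of k 1 "\<lambda>i. B (u i) (u i)" n] by (simp add: bdf_dot_def)
  finally show ?thesis ..
qed

lemma norm_diff_initial_le:
  fixes u :: "nat \<Rightarrow> 'a::real_normed_vector"
  assumes "\<And>i. i \<le> n \<Longrightarrow> norm (bdiff u i) \<le> K"
  shows "norm (u n - u 0) \<le> real n * K"
  using assms
proof (induction n)
  case (Suc n)
  have "u (Suc n) - u 0 = bdiff u (Suc n) + (u n - u 0)" by (simp add: bdiff_def)
  then have "norm (u (Suc n) - u 0) \<le> norm (bdiff u (Suc n)) + norm (u n - u 0)"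
    by (metis norm_triangle_ineq)
  also have "\<dots> \<le> K + real n * K"
    using Suc by (intro add_mono) auto
  finally show ?case by (simp add: algebra_simps)
qed simp

text \<open>A crude bound through first differences, which needs no cancellation and holds for every
  order. The factor n makes it unsuitable for long sums; it serves the finitely many starting steps,
  where first differences of size O(s) suffice for O(s^2).\<close>

lemma norm_bdf_remainder_le:
  fixes u :: "nat \<Rightarrow> 'a::real_normed_vector" and B :: "'a \<Rightarrow> 'a \<Rightarrow> 'b::real_normed_vector"
  assumes "k \<ge> 1" "0 \<le> c" "\<And>v. norm (B v v) \<le> c * (norm v)\<^sup>2"
    and "\<And>i. i \<le> n \<Longrightarrow> norm (bdiff u i) \<le> K"
  shows "norm (bdf_remainder k B u n) \<le> (\<Sum>j=0..k. \<bar>bdf_delta k j\<bar>)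
    * (c * ((1 + (\<Sum>j=0..<k. \<bar>bdf_gamma k j\<bar>)) * real n * K)\<^sup>2)"
proof -
  let ?h = "bdf_hat k u n" and ?G = "\<Sum>j=0..<k. \<bar>bdf_gamma k j\<bar>"
  have "0 \<le> K" using assms(4)[of 0] norm_ge_zero[of "bdiff u 0"] by linarith
  have near: "norm (u i - u 0) \<le> real n * K" if "i \<le> n" for i
  proof -
    have "norm (u i - u 0) \<le> real i * K"
      using that assms(4) by (intro norm_diff_initial_le) auto
    also have "\<dots> \<le> real n * K" using that \<open>0 \<le> K\<close> by (intro mult_right_mono) auto
    finally show ?thesis .
  qed
  \<comment> \<open>As the gamma_j add up to 1, the point \<open>u 0\<close> can be moved inside the
    extrapolation, whose entries all stay close to it.\<close>
  have "?h - u 0 = ?h - (\<Sum>j=0..<k. bdf_gamma k j) *\<^sub>R u 0"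
    using sum_bdf_gamma[OF assms(1)] by simp
  also have "\<dots> = (\<Sum>j=0..<k. bdf_gamma k j *\<^sub>R (u (n - j - 1) - u 0))"
    by (simp add: bdf_hat_def scaleR_sum_left sum_subtractf scaleR_diff_right)
  finally have "norm (?h - u 0) \<le> ?G * (real n * K)"
    unfolding sum_distrib_right
    by (simp only:) (rule sum_norm_le, use near in \<open>simp add: mult_left_mono\<close>)
  then have e: "norm (u (n - j) - ?h) \<le> (1 + ?G) * real n * K" for j
    using near[of "n - j"] norm_triangle_ineq4[of "u (n - j) - u 0" "?h - u 0"]
    by (simp add: algebra_simps)
  show ?thesis
    unfolding bdf_remainder_def sum_distrib_right
  proof (rule sum_norm_le)
    fix j
    have "norm (B (u (n - j) - ?h) (u (n - j) - ?h)) \<le> c * (norm (u (n - j) - ?h))\<^sup>2"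
      by (rule assms(3))
    also have "\<dots> \<le> c * ((1 + ?G) * real n * K)\<^sup>2"
      using assms(2) e[of j] by (intro mult_left_mono power_mono) auto
    finally show "norm (bdf_delta k j *\<^sub>R B (u (n - j) - ?h) (u (n - j) - ?h))
        \<le> \<bar>bdf_delta k j\<bar> * (c * ((1 + ?G) * real n * K)\<^sup>2)"
      by (simp add: mult_left_mono)
  qed
qed

section \<open>Cancellation of first differences in the remainder\<close>

lemma bdf_hat_2: "bdf_hat 2 u n = 2 *\<^sub>R u (n - 1) - u (n - 2)"
  by (simp add: bdf_hat_def bdf_gamma_def numeral_eq_Suc)

lemma bdf_hat_3: "bdf_hat 3 u n = 3 *\<^sub>R u (n - 1) - 3 *\<^sub>R u (n - 2) + u (n - 3)"
  by (simp add: bdf_hat_def bdf_gamma_def numeral_eq_Suc)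

lemma bdf_hat_4:
  "bdf_hat 4 u n = 4 *\<^sub>R u (n - 1) - 6 *\<^sub>R u (n - 2) + 4 *\<^sub>R u (n - 3) - u (n - 4)"
  by (simp add: bdf_hat_def bdf_gamma_def numeral_eq_Suc)

lemma sum_bdf_delta_2:
  "(\<Sum>j=0..2. bdf_delta 2 j *\<^sub>R f j) = (3/2) *\<^sub>R f 0 + (-2) *\<^sub>R f 1 + (1/2) *\<^sub>R f 2"
  by (simp add: bdf_delta_def numeral_eq_Suc)

lemma sum_bdf_delta_3:
  "(\<Sum>j=0..3. bdf_delta 3 j *\<^sub>R f j) =
    (11/6) *\<^sub>R f 0 + (-3) *\<^sub>R f 1 + (3/2) *\<^sub>R f 2 + (-1/3) *\<^sub>R f 3"
  by (simp add: bdf_delta_def numeral_eq_Suc)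

lemma sum_bdf_delta_4:
  "(\<Sum>j=0..4. bdf_delta 4 j *\<^sub>R f j) =
    (25/12) *\<^sub>R f 0 + (-4) *\<^sub>R f 1 + 3 *\<^sub>R f 2 + (-4/3) *\<^sub>R f 3 + (1/4) *\<^sub>R f 4"
  by (simp add: bdf_delta_def numeral_eq_Suc)

text \<open>Each deviation e_j equals -j times the last known first difference D plus second
  differences. The terms B(D, D) have total weight sum_j j^2 delta_j = -2 + 2 = 0.\<close>

lemma bdf_remainder_2:
  fixes B :: "'a::real_normed_vector \<Rightarrow> 'a \<Rightarrow> 'b::real_normed_vector"
    and u :: "nat \<Rightarrow> 'a" and n :: nat
  assumes "bilinear B"
  shows "bdf_remainder 2 B u n = (3/2) *\<^sub>R B (bdiff (bdiff u) n) (bdiff (bdiff u) n)"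
proof -
  define D where "D = bdiff u (n - 1)"
  have idx: "n - 1 - 1 = n - 2" by simp
  have e: "u (n - 0) - bdf_hat 2 u n = bdiff (bdiff u) n" "u (n - 1) - bdf_hat 2 u n = (-1) *\<^sub>R D"
     "u (n - 2) - bdf_hat 2 u n = (-2) *\<^sub>R D"
    unfolding D_def bdiff_def bdf_hat_2 idx diff_zero by norm+
  show ?thesis
    unfolding bdf_remainder_def sum_bdf_delta_2 e
      bilinear_lmul[OF assms] bilinear_rmul[OF assms] by simp
qed

lemma bdf_remainder_3:
  fixes B :: "'a::real_normed_vector \<Rightarrow> 'a \<Rightarrow> 'b::real_normed_vector"
    and u :: "nat \<Rightarrow> 'a" and n :: nat
  assumes "bilinear B" "symmetric_form B"
  defines "W \<equiv> bdiff (bdiff u)"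
  shows "bdf_remainder 3 B u n = (11/6) *\<^sub>R B (W n - W (n - 1)) (W n - W (n - 1))
    + (-3/2) *\<^sub>R B (W (n - 1)) (W (n - 1))"
proof -
  define D where "D = bdiff u (n - 1)"
  have idx: "n - 1 - 1 = n - 2" "n - 2 - 1 = n - 3" by simp_all
  have e: "u (n - 0) - bdf_hat 3 u n = W n - W (n - 1)"
     "u (n - 1) - bdf_hat 3 u n = (-1) *\<^sub>R D - W (n - 1)"
     "u (n - 2) - bdf_hat 3 u n = (-2) *\<^sub>R D - W (n - 1)"
     "u (n - 3) - bdf_hat 3 u n = (-3) *\<^sub>R D"
    unfolding D_def W_def bdiff_def bdf_hat_3 idx diff_zero by norm+
  show ?thesis
    unfolding bdf_remainder_def sum_bdf_delta_3 e
    unfolding bilinear_diff_square[OF assms(1,2)]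
      bilinear_lmul[OF assms(1)] bilinear_rmul[OF assms(1)] by norm
qed

text \<open>The weight of B(D, D) is -4 + 12 - 12 + 4 = 0. The mixed terms add up to 4 B(g, D) - 8
  B(h, D) - 4 B(W (n - 2), D), which vanishes once g and h are expanded. The combinations f, g, h
  are kept inside B so that only diagonal values occur, the ones controlled by the growth
  bound.\<close>

lemma bdf_remainder_4:
  fixes B :: "'a::real_normed_vector \<Rightarrow> 'a \<Rightarrow> 'b::real_normed_vector"
    and u :: "nat \<Rightarrow> 'a" and n :: nat
  assumes "bilinear B" "symmetric_form B"
  defines "W \<equiv> bdiff (bdiff u)"
  defines "f \<equiv> W n - (2 *\<^sub>R W (n - 1) - W (n - 2))" and "g \<equiv> 2 *\<^sub>R W (n - 1) - W (n - 2)"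
    and "h \<equiv> W (n - 1) - W (n - 2)"
  shows "bdf_remainder 4 B u n = (25/12) *\<^sub>R B f f + (-1) *\<^sub>R B g g + (-4/3) *\<^sub>R B h h
    + B (W (n - 2)) (W (n - 2))"
proof -
  define D where "D = bdiff u (n - 1)"
  have idx: "n - 1 - 1 = n - 2" "n - 2 - 1 = n - 3" "n - 3 - 1 = n - 4" by simp_all
  have e: "u (n - 0) - bdf_hat 4 u n = f"
     "u (n - 1) - bdf_hat 4 u n = (-1) *\<^sub>R D - g"
     "u (n - 2) - bdf_hat 4 u n = (-2) *\<^sub>R D - g"
     "u (n - 3) - bdf_hat 4 u n = (-3) *\<^sub>R D - h"
     "u (n - 4) - bdf_hat 4 u n = (-4) *\<^sub>R D - (-2) *\<^sub>R W (n - 2)"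
    unfolding f_def g_def h_def D_def W_def bdiff_def bdf_hat_4 idx diff_zero by norm+
  \<comment> \<open>Only the products with D are expanded; the diagonal terms in g and h stay
    intact.\<close>
  have cross: "B g D = 2 *\<^sub>R B (W (n - 1)) D - B (W (n - 2)) D"
    "B h D = B (W (n - 1)) D - B (W (n - 2)) D"
    unfolding g_def h_def by (simp_all add: bilinear_lsub[OF assms(1)] bilinear_lmul[OF assms(1)])
  show ?thesis
    unfolding bdf_remainder_def sum_bdf_delta_4 e
    unfolding bilinear_diff_square[OF assms(1,2)]
      bilinear_lmul[OF assms(1)] bilinear_rmul[OF assms(1)] cross by norm
qed

text \<open>Every argument of B has norm at most twice the sum of three norms, whose square is at
  most 12 times the sum of squares. The absolute coefficients add up to at most 65/12 (order 4), so
  6 * 12 = 72 suffices.\<close>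

lemma norm_bdf_remainder_bdiff2_le:
  fixes B :: "'a::real_normed_vector \<Rightarrow> 'a \<Rightarrow> 'b::real_normed_vector"
    and u :: "nat \<Rightarrow> 'a" and n :: nat
  assumes B: "bilinear B" "symmetric_form B"
    and c: "0 \<le> c" "\<And>v. norm (B v v) \<le> c * (norm v)\<^sup>2"
    and k: "2 \<le> k" "k \<le> 4"
  defines "W \<equiv> bdiff (bdiff u)"
  shows "norm (bdf_remainder k B u n)
    \<le> 72 * c * ((norm (W n))\<^sup>2 + (norm (W (n - 1)))\<^sup>2 + (norm (W (n - 2)))\<^sup>2)"
proof -
  let ?S = "(norm (W n))\<^sup>2 + (norm (W (n - 1)))\<^sup>2 + (norm (W (n - 2)))\<^sup>2"
  have S: "norm (B v v) \<le> 12 * c * ?S"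
    if "norm v \<le> 2 * norm (W n) + 2 * norm (W (n - 1)) + 2 * norm (W (n - 2))" for v
  proof -
    let ?a = "norm (W n)" and ?b = "norm (W (n - 1))" and ?d = "norm (W (n - 2))"
    have "(norm v)\<^sup>2 \<le> (2 * ?a + 2 * ?b + 2 * ?d)\<^sup>2"
      using that by (intro power_mono) auto
    also have "\<dots> \<le> 12 * ?S"
      using sum_squares_bound[of ?a ?b] sum_squares_bound[of ?a ?d] sum_squares_bound[of ?b ?d]
      by (simp add: power2_eq_square algebra_simps)
    finally have "c * (norm v)\<^sup>2 \<le> c * (12 * ?S)" using c(1) by (rule mult_left_mono)
    with c(2)[of v] show ?thesis by (simp only: mult.assoc mult.left_commute)
  qed
  have "0 \<le> c * ?S" using c(1) by simp
  from k show ?thesis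
  proof (cases k rule: bdf_cases)
    case 1
    have "norm (B (W n) (W n)) \<le> 12 * c * ?S"
      by (rule S) (simp add: add_nonneg_nonneg)
    with \<open>0 \<le> c * ?S\<close> show ?thesis
      unfolding 1 bdf_remainder_2[OF B(1)] W_def[symmetric] by simp
  next
    case 2
    let ?e = "W n - W (n - 1)"
    have "norm (B ?e ?e) \<le> 12 * c * ?S"
      by (rule S) norm
    moreover have "norm (B (W (n - 1)) (W (n - 1))) \<le> 12 * c * ?S"
      by (rule S) norm
    moreover have "norm (bdf_remainder 3 B u n) \<le> 11/6 * norm (B ?e ?e)
        + 3/2 * norm (B (W (n - 1)) (W (n - 1)))"
      unfolding bdf_remainder_3[OF B] W_def[symmetric] by (intro norm_triangle_mono) simp_all
    ultimately show ?thesis unfolding 2 using \<open>0 \<le> c * ?S\<close> by argo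
  next
    case 3
    let ?f = "W n - (2 *\<^sub>R W (n - 1) - W (n - 2))" and ?g = "2 *\<^sub>R W (n - 1) - W (n - 2)"
      and ?h = "W (n - 1) - W (n - 2)"
    have "norm (B ?f ?f) \<le> 12 * c * ?S" "norm (B ?g ?g) \<le> 12 * c * ?S"
      "norm (B ?h ?h) \<le> 12 * c * ?S" "norm (B (W (n - 2)) (W (n - 2))) \<le> 12 * c * ?S"
      by (rule S, norm)+
    moreover have "norm (bdf_remainder 4 B u n) \<le> 25/12 * norm (B ?f ?f) + norm (B ?g ?g)
        + 4/3 * norm (B ?h ?h) + norm (B (W (n - 2)) (W (n - 2)))"
      unfolding bdf_remainder_4[OF B] W_def[symmetric] by (intro norm_triangle_mono) simp_all
    ultimately show ?thesis unfolding 3 using \<open>0 \<le> c * ?S\<close> by argo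
  qed
qed

subsection \<open>Energy estimate\<close>

locale bdf_setting =
  fixes M :: "'u::real_inner \<Rightarrow> 'u \<Rightarrow> real"
    and B :: "'u \<Rightarrow> 'u \<Rightarrow> 'z::real_normed_vector"
    and c C\<^sub>1 C\<^sub>2 \<alpha> :: real and U\<^sub>0 :: "'u set"
  assumes bilinear_B: "bilinear B" and symmetric_B: "symmetric_form B"
    and c_nonneg: "0 \<le> c" and norm_B_le: "\<And>v. norm (B v v) \<le> c * (norm v)\<^sup>2"
    and bilinear_M: "bilinear M" and symmetric_M: "symmetric_form M"
    and C\<^sub>1_pos: "0 < C\<^sub>1" and C\<^sub>2_pos: "0 < C\<^sub>2"
    and coercive_M: "\<And>v. C\<^sub>1 * (norm v)\<^sup>2 \<le> M v v"
    and M_le: "\<And>v. M v v \<le> C\<^sub>2 * (norm v)\<^sup>2"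
    and \<alpha>_nonneg: "0 \<le> \<alpha>"
begin

abbreviation step :: "nat \<Rightarrow> real \<Rightarrow> (nat \<Rightarrow> 'u) \<Rightarrow> nat \<Rightarrow> bool" where
  "step k s \<equiv> bdf_step k \<alpha> s M (tangent_space U\<^sub>0 B)"

lemma M_nonneg: "0 \<le> M v v"
  using coercive_M[of v] C\<^sub>1_pos by (smt (verit) mult_nonneg_nonneg zero_le_power2)

text \<open>The quotient \<open>bdf_dot k s u n\<close> lies in the space of test directions, so it
  may be tested with itself. Both resulting products telescope up to nonnegative squares by
  polarization; the second one does because s times the quotient is the increment of the tilde
  values.\<close>

lemma energy_step:
  assumes "step k s u n" "s > 0"
  shows "(norm (bdf_dot k s u n))\<^sup>2 + (norm (bdf_dot k s u n - bdf_dot k s u (n - 1)))\<^sup>2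
      + M (bdf_tilde k u n) (bdf_tilde k u n)
    \<le> (norm (bdf_dot k s u (n - 1)))\<^sup>2 + M (bdf_tilde k u (n - 1)) (bdf_tilde k u (n - 1))"
proof -
  define v where "v = bdf_dot k s u n"
  define v' where "v' = bdf_dot k s u (n - 1)"
  define x where "x = bdf_tilde k u n"
  define x' where "x' = bdf_tilde k u (n - 1)"
  have diff: "s *\<^sub>R v = x - x'"
    using assms(2) by (simp add: v_def x_def x'_def bdf_dot_eq bdf_tilde_bdiff bdiff_def)
  have "(1 / s) *\<^sub>R (v - v') \<bullet> v + \<alpha> / (real n * s) * (v \<bullet> v) + M x v = 0"
    using assms(1) unfolding bdf_step_def v_def v'_def x_def by blast
  \<comment> \<open>The damping only dissipates energy. At n = 0 the quotient is 0 by the convention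
    for division by zero.\<close>
  moreover have "0 \<le> \<alpha> / (real n * s) * (v \<bullet> v)"
    using \<alpha>_nonneg assms(2) by simp
  ultimately have "s * ((1 / s) *\<^sub>R (v - v') \<bullet> v + M x v) \<le> 0"
    using assms(2) by (intro mult_nonneg_nonpos) auto
  then have test: "(v - v') \<bullet> v + s * M x v \<le> 0"
    using assms(2) by (simp add: distrib_left)
  have "2 * ((v - v') \<bullet> v) = (norm v)\<^sup>2 - (norm v')\<^sup>2 + (norm (v - v'))\<^sup>2"
    by (simp add: power2_norm_eq_inner inner_diff_left inner_diff_right inner_commute)
  moreover have "2 * (s * M x v) = M x x - M x' x' + M (x - x') (x - x')"
  proof -
    have "s * M x v = M x (x - x')"
      by (simp add: diff[symmetric] bilinear_rmul[OF bilinear_M])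
    then show ?thesis
      using bilinear_diff_square[OF bilinear_M symmetric_M, of x x'] symmetric_M
      by (simp add: bilinear_rsub[OF bilinear_M] symmetric_form_def)
  qed
  ultimately show ?thesis
    using test M_nonneg[of "x - x'"] unfolding v_def v'_def x_def x'_def by linarith
qed

lemma bdf_tilde_bdiff_constraint:
  assumes "step k s u n" "s > 0"
  shows "bdf_tilde k (bdiff (\<lambda>i. B (u i) (u i) - z)) n = bdf_remainder k B u n"
proof -
  have "bdiff (\<lambda>i. B (u i) (u i) - z) = bdiff (\<lambda>i. B (u i) (u i))"
    by (simp add: bdiff_def fun_eq_iff)
  with assms show ?thesis
    using bdf_tilde_bdiff_square[OF bilinear_B symmetric_B, of s k u n]
    by (simp add: bdf_step_def tangent_space_def)
qed

lemma norm_bdf_dot_le: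
  assumes "s > 0" "\<And>i. i \<le> n \<Longrightarrow> norm (bdiff u i) \<le> K * s"
  shows "norm (bdf_dot k s u n) \<le> (\<Sum>j=0..<k. \<bar>bdf_delta_tilde k j\<bar>) * K"
proof -
  have "norm (bdf_tilde k (bdiff u) n) \<le> (\<Sum>j=0..<k. \<bar>bdf_delta_tilde k j\<bar>) * (K * s)"
    using assms(2) by (rule norm_bdf_tilde_le)
  then show ?thesis
    using assms(1) by (simp add: bdf_dot_eq field_simps)
qed

lemma energy_le:
  assumes "s > 0" "\<And>i. i \<le> n \<Longrightarrow> norm (u i) \<le> K" "\<And>i. i \<le> n \<Longrightarrow> norm (bdiff u i) \<le> K * s"
  shows "(norm (bdf_dot k s u n))\<^sup>2 + M (bdf_tilde k u n) (bdf_tilde k u n)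
    \<le> (1 + C\<^sub>2) * ((\<Sum>j=0..<k. \<bar>bdf_delta_tilde k j\<bar>) * K)\<^sup>2"
proof -
  let ?A = "\<Sum>j=0..<k. \<bar>bdf_delta_tilde k j\<bar>"
  have "(norm (bdf_dot k s u n))\<^sup>2 \<le> (?A * K)\<^sup>2"
    by (intro power_mono norm_bdf_dot_le assms) auto
  moreover have "M (bdf_tilde k u n) (bdf_tilde k u n) \<le> C\<^sub>2 * (?A * K)\<^sup>2"
  proof (rule order_trans[OF M_le])
    show "C\<^sub>2 * (norm (bdf_tilde k u n))\<^sup>2 \<le> C\<^sub>2 * (?A * K)\<^sup>2"
      using C\<^sub>2_pos by (intro mult_left_mono power_mono norm_bdf_tilde_le assms) auto
  qed
  ultimately show ?thesis by (simp add: algebra_simps)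
qed

section \<open>The starting values\<close>

text \<open>The energy depends on the order, so it does not telescope across starting steps of
  different order. Instead each step is estimated afresh from the bounds on all earlier values, by
  induction on the number of steps. The constant is chosen before s and u, and the powers of s match
  the three quantities.\<close>

lemma initial_bounds:
  assumes "B u\<^sub>0 u\<^sub>0 = z"
  shows "\<exists>K\<ge>0. \<forall>s>0. \<forall>u. u 0 = u\<^sub>0 \<and> (\<forall>p. 1 \<le> p \<and> p \<le> m \<longrightarrow> step p s u p) \<longrightarrow>
    (\<forall>i\<le>m. norm (u i) \<le> K \<and> norm (bdiff u i) \<le> K * s \<and> norm (B (u i) (u i) - z) \<le> K * s\<^sup>2)"
proof (induction m)
  case 0
  show ?case
    using assms by (intro exI[of _ "norm u\<^sub>0"]) (auto simp: bdiff_def)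
next
  case (Suc m)
  then obtain K where K: "0 \<le> K" and
    IH: "\<And>s u i. \<lbrakk>0 < s; u 0 = u\<^sub>0; \<And>p. 1 \<le> p \<Longrightarrow> p \<le> m \<Longrightarrow> step p s u p; i \<le> m\<rbrakk> \<Longrightarrow>
      norm (u i) \<le> K \<and> norm (bdiff u i) \<le> K * s \<and> norm (B (u i) (u i) - z) \<le> K * s\<^sup>2"
    by blast
  let ?p = "Suc m"
  \<comment> \<open>\<open>A\<close> bounds the tilde operator on earlier values, \<open>R\<close>
    the energy before the new step, \<open>K\<^sub>1\<close> the first differences divided by s,
    \<open>Q\<close> the remainder divided by s^2. \<open>L\<close> dominates the three bounds at
    the new index and the old constant.\<close>
  define A where "A = (\<Sum>j=0..<?p. \<bar>bdf_delta_tilde ?p j\<bar>)"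
  define R where "R = (1 + C\<^sub>2) * (A * K)\<^sup>2"
  define K\<^sub>1 where "K\<^sub>1 = max K (sqrt R + A * K)"
  define Q where "Q = (\<Sum>j=0..?p. \<bar>bdf_delta ?p j\<bar>)
    * (c * ((1 + (\<Sum>j=0..<?p. \<bar>bdf_gamma ?p j\<bar>)) * real ?p * K\<^sub>1)\<^sup>2)"
  define L where "L = max (max K\<^sub>1 (sqrt (R / C\<^sub>1) + A * K)) (Q + A * K + A * K)"
  have L: "K \<le> L" "K\<^sub>1 \<le> L" "sqrt (R / C\<^sub>1) + A * K \<le> L" "Q + A * K + A * K \<le> L"
    by (auto simp: L_def K\<^sub>1_def)
  have bounds: "norm (u i) \<le> L \<and> norm (bdiff u i) \<le> L * s \<and> norm (B (u i) (u i) - z) \<le> L * s\<^sup>2"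
    if s: "0 < s" and u0: "u 0 = u\<^sub>0" and steps: "\<And>p. 1 \<le> p \<Longrightarrow> p \<le> ?p \<Longrightarrow> step p s u p"
      and i: "i \<le> ?p" for s u i
  proof -
    let ?b = "\<lambda>i. B (u i) (u i) - z"
    have old: "norm (u i) \<le> K" "norm (bdiff u i) \<le> K * s" "norm (?b i) \<le> K * s\<^sup>2" if "i \<le> m" for i
      using IH[of s u i] s u0 steps that by auto
    show ?thesis
    proof (cases "i \<le> m")
      case True
      have "K * s \<le> L * s" "K * s\<^sup>2 \<le> L * s\<^sup>2"
        using L(1) s by (auto intro: mult_right_mono)
      with old[OF True] L(1) show ?thesis by linarith
    next
      case False
      with i have i: "i = ?p" by simp
      have step: "step ?p s u ?p" using steps by simp
      \<comment> \<open>The order ?p energy at index m involves only values up to m, which are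
        already bounded; the step carries this bound to index ?p.\<close>
      have energy: "(norm (bdf_dot ?p s u ?p))\<^sup>2 + M (bdf_tilde ?p u ?p) (bdf_tilde ?p u ?p) \<le> R"
        using energy_step[OF step s] energy_le[OF s, of m u K ?p] old
        by (simp add: A_def R_def) (smt (verit) zero_le_power2)
      have "(norm (bdf_dot ?p s u ?p))\<^sup>2 \<le> R"
        using energy M_nonneg[of "bdf_tilde ?p u ?p"] by linarith
      then have dot: "norm (bdf_dot ?p s u ?p) \<le> sqrt R"
        by (rule real_le_rsqrt)
      have "C\<^sub>1 * (norm (bdf_tilde ?p u ?p))\<^sup>2 \<le> R"
        using energy coercive_M[of "bdf_tilde ?p u ?p"] zero_le_power2[of "norm (bdf_dot ?p s u ?p)"]
        by linarith
      then have tilde: "norm (bdf_tilde ?p u ?p) \<le> sqrt (R / C\<^sub>1)"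
        using C\<^sub>1_pos by (intro real_le_rsqrt) (simp add: field_simps)
      have "norm (u ?p) \<le> norm (bdf_tilde ?p u ?p) + A * K"
        unfolding A_def using old by (intro norm_le_bdf_tilde) auto
      with tilde L(3) have u: "norm (u ?p) \<le> L" by linarith
      have "bdf_tilde ?p (bdiff u) ?p = s *\<^sub>R bdf_dot ?p s u ?p"
        using s by (simp add: bdf_dot_eq)
      then have "norm (bdf_tilde ?p (bdiff u) ?p) \<le> s * sqrt R"
        using s dot by simp
      moreover have "norm (bdiff u ?p) \<le> norm (bdf_tilde ?p (bdiff u) ?p) + A * (K * s)"
        unfolding A_def using old by (intro norm_le_bdf_tilde) auto
      ultimately have "norm (bdiff u ?p) \<le> (sqrt R + A * K) * s"
        by (simp add: algebra_simps)
      also have "\<dots> \<le> K\<^sub>1 * s"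
        using s by (intro mult_right_mono) (auto simp: K\<^sub>1_def)
      finally have du: "norm (bdiff u ?p) \<le> K\<^sub>1 * s" .
      have "K * s \<le> K\<^sub>1 * s" using s by (intro mult_right_mono) (auto simp: K\<^sub>1_def)
      have "norm (bdiff u j) \<le> K\<^sub>1 * s" if "j \<le> ?p" for j
        using du old(2)[of j] \<open>K * s \<le> K\<^sub>1 * s\<close> that by (cases "j = ?p") auto
      then have "norm (bdf_remainder ?p B u ?p) \<le> (\<Sum>j=0..?p. \<bar>bdf_delta ?p j\<bar>)
          * (c * ((1 + (\<Sum>j=0..<?p. \<bar>bdf_gamma ?p j\<bar>)) * real ?p * (K\<^sub>1 * s))\<^sup>2)"
        using c_nonneg norm_B_le by (intro norm_bdf_remainder_le) auto
      also have "\<dots> = Q * s\<^sup>2"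
        by (simp add: Q_def power_mult_distrib del: of_nat_Suc sum.op_ivl_Suc sum.cl_ivl_Suc)
      finally have rem: "norm (bdf_remainder ?p B u ?p) \<le> Q * s\<^sup>2" .
      \<comment> \<open>The remainder is the increment of the tilde constraint values, so the new
        one is the sum of two quantities of size O(s^2).\<close>
      have "bdf_tilde ?p ?b ?p = bdf_remainder ?p B u ?p + bdf_tilde ?p ?b m"
        using bdf_tilde_bdiff_constraint[OF step s, of z]
        by (simp add: bdf_tilde_bdiff bdiff_def algebra_simps)
      moreover have "norm (bdf_tilde ?p ?b m) \<le> A * (K * s\<^sup>2)"
        unfolding A_def using old by (intro norm_bdf_tilde_le) auto
      ultimately have "norm (bdf_tilde ?p ?b ?p) \<le> Q * s\<^sup>2 + A * (K * s\<^sup>2)"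
        using rem norm_triangle_ineq[of "bdf_remainder ?p B u ?p" "bdf_tilde ?p ?b m"] by simp
      moreover have "norm (?b ?p) \<le> norm (bdf_tilde ?p ?b ?p) + A * (K * s\<^sup>2)"
        unfolding A_def using old by (intro norm_le_bdf_tilde) auto
      ultimately have "norm (?b ?p) \<le> (Q + A * K + A * K) * s\<^sup>2"
        by (simp add: algebra_simps)
      also have "\<dots> \<le> L * s\<^sup>2"
        using L(4) by (intro mult_right_mono) auto
      finally have "norm (?b ?p) \<le> L * s\<^sup>2" .
      moreover have "K\<^sub>1 * s \<le> L * s" using L(2) s by (intro mult_right_mono) auto
      ultimately show ?thesis using u du by (simp add: i)
    qed
  qed
  show ?case
    using bounds K L(1) by (intro exI[of _ L]) auto
qed

section \<open>Summation over the steps of fixed order\<close>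

text \<open>Each squared increment is at most the energy lost in that step; the losses telescope,
  and the final energy is nonnegative. The sum starts at k, the first index where the order k step
  holds.\<close>

lemma sum_dot_increments_le:
  assumes "s > 0" "\<And>n. k \<le> n \<Longrightarrow> step k s u n" "k \<ge> 1"
  shows "(\<Sum>n=k..N. (norm (bdf_dot k s u n - bdf_dot k s u (n - 1)))\<^sup>2)
    \<le> (norm (bdf_dot k s u (k - 1)))\<^sup>2 + M (bdf_tilde k u (k - 1)) (bdf_tilde k u (k - 1))"
proof -
  define E where "E n = (norm (bdf_dot k s u n))\<^sup>2 + M (bdf_tilde k u n) (bdf_tilde k u n)" for n
  have E: "0 \<le> E n" for n using M_nonneg by (simp add: E_def)
  have dec: "(norm (bdf_dot k s u n - bdf_dot k s u (n - 1)))\<^sup>2 \<le> E (n - 1) - E n" if "k \<le> n" for n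
    using energy_step[OF assms(2)[OF that] assms(1)] by (simp add: E_def)
  show ?thesis
  proof (cases "k \<le> N")
    case True
    have "(\<Sum>n=k..N. (norm (bdf_dot k s u n - bdf_dot k s u (n - 1)))\<^sup>2)
        \<le> (\<Sum>n=k..N. E (n - 1) - E n)"
      using dec by (intro sum_mono) auto
    also have "\<dots> = E (k - 1) - E N"
      using True assms(3) sum_telescope''[of "k - 1" N "\<lambda>n. - E n"] by simp
    finally show ?thesis using E[of N] by (simp add: E_def)
  next
    case False
    then show ?thesis using E[of "k - 1"] by (simp add: E_def)
  qed
qed

lemma constraint_violation_le:
  assumes z: "B u\<^sub>0 u\<^sub>0 = z" and k: "2 \<le> k" "k \<le> 4"
  shows "\<exists>C\<ge>0. \<forall>s>0. \<forall>u. bdf_accelerated_sequence k \<alpha> s M (tangent_space U\<^sub>0 B) u\<^sub>0 u \<longrightarrow>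
    (\<forall>N. norm (B (u N) (u N) - z) \<le> C * s\<^sup>2)"
proof -
  obtain K where K: "0 \<le> K" and
    init: "\<And>s u i. \<lbrakk>0 < s; u 0 = u\<^sub>0; \<And>p. 1 \<le> p \<Longrightarrow> p \<le> k - 1 \<Longrightarrow> step p s u p; i \<le> k - 1\<rbrakk> \<Longrightarrow>
      norm (u i) \<le> K \<and> norm (bdiff u i) \<le> K * s \<and> norm (B (u i) (u i) - z) \<le> K * s\<^sup>2"
    using initial_bounds[OF z, of "k - 1"] by blast
  define A where "A = (\<Sum>j=0..<k. \<bar>bdf_delta_tilde k j\<bar>)"
  \<comment> \<open>\<open>P\<close> comes from \<open>bdf_tilde_l2_stability\<close> for the second
    differences: k initial squares, the tilde value at k - 1, and the initial energy.
    \<open>C\<close> comes from \<open>bdf_tilde_sup_stability\<close>, whose bound on the tilde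
    constraint values is the initial part plus the sum of all remainders.\<close>
  define P where "P = 11/2 * (real k * (2 * K)\<^sup>2) + 121 * ((A * (2 * K))\<^sup>2 + (1 + C\<^sub>2) * (A * K)\<^sup>2)"
  define C where "C = K + 11 * (A * K + 72 * c * (3 * P))"
  have "0 \<le> A" unfolding A_def by (intro sum_nonneg) auto
  have "0 \<le> P" unfolding P_def using C\<^sub>2_pos by (intro add_nonneg_nonneg mult_nonneg_nonneg) auto
  have "norm (B (u N) (u N) - z) \<le> C * s\<^sup>2"
    if s: "0 < s" and u: "bdf_accelerated_sequence k \<alpha> s M (tangent_space U\<^sub>0 B) u\<^sub>0 u" for s u N
  proof -
    let ?b = "\<lambda>i. B (u i) (u i) - z"
    define W where "W = bdiff (bdiff u)"
    have start: "norm (u i) \<le> K" "norm (bdiff u i) \<le> K * s" "norm (?b i) \<le> K * s\<^sup>2"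
      if "i \<le> k - 1" for i
      using init[OF s _ _ that, of u] u by (auto simp: bdf_accelerated_sequence_def)
    have step: "step k s u n" if "k \<le> n" for n
      using u that by (simp add: bdf_accelerated_sequence_def)
    have W_start: "norm (W i) \<le> 2 * K * s" if "i \<le> k - 1" for i
      using start(2)[OF that] start(2)[of "i - 1"] diff_le_self[of i 1, THEN order_trans, OF that]
        norm_triangle_ineq4[of "bdiff u i" "bdiff u (i - 1)"]
      by (simp add: W_def bdiff_def[of "bdiff u"])
    \<comment> \<open>This factor s is the source of s^2: the squared increments of the quotient
      have a sum bounded independently of s and of the number of steps.\<close>
    have tilde_W: "bdf_tilde k W n = s *\<^sub>R (bdf_dot k s u n - bdf_dot k s u (n - 1))" for n
      using s by (simp add: W_def bdf_tilde_bdiff[of k "bdiff u"] bdiff_def[of "bdf_tilde k (bdiff u)"]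
          bdf_dot_eq scaleR_diff_right)
    have W_sum: "(\<Sum>n=0..m. (norm (W n))\<^sup>2) \<le> P * s\<^sup>2" for m
    proof -
      have "(\<Sum>n<k. (norm (W n))\<^sup>2) \<le> (\<Sum>n<k. (2 * K * s)\<^sup>2)"
        using W_start by (intro sum_mono power_mono) auto
      then have 1: "(\<Sum>n<k. (norm (W n))\<^sup>2) \<le> real k * (2 * K)\<^sup>2 * s\<^sup>2"
        by (simp add: power_mult_distrib)
      have "norm (bdf_tilde k W (k - 1)) \<le> A * (2 * K * s)"
        unfolding A_def using W_start by (rule norm_bdf_tilde_le)
      then have "(norm (bdf_tilde k W (k - 1)))\<^sup>2 \<le> (A * (2 * K * s))\<^sup>2"
        by (intro power_mono) auto
      then have 2: "(norm (bdf_tilde k W (k - 1)))\<^sup>2 \<le> (A * (2 * K))\<^sup>2 * s\<^sup>2"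
        by (simp add: power_mult_distrib)
      have "(\<Sum>n=k..m. (norm (bdf_tilde k W n))\<^sup>2)
          = s\<^sup>2 * (\<Sum>n=k..m. (norm (bdf_dot k s u n - bdf_dot k s u (n - 1)))\<^sup>2)"
        by (simp add: tilde_W power_mult_distrib sum_distrib_left)
      also have "\<dots> \<le> s\<^sup>2 * ((1 + C\<^sub>2) * (A * K)\<^sup>2)"
      proof (intro mult_left_mono)
        show "(\<Sum>n=k..m. (norm (bdf_dot k s u n - bdf_dot k s u (n - 1)))\<^sup>2) \<le> (1 + C\<^sub>2) * (A * K)\<^sup>2"
          using sum_dot_increments_le[of s k u m] energy_le[of s "k - 1" u K k] s step start(1,2) k
          unfolding A_def by force
      qed simp
      finally have 3: "(\<Sum>n=k..m. (norm (bdf_tilde k W n))\<^sup>2) \<le> (1 + C\<^sub>2) * (A * K)\<^sup>2 * s\<^sup>2"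
        by (simp add: mult.commute)
      \<comment> \<open>The stability lemma needs the index k - 1 as well. The energy decay says
        nothing there, so that term is bounded from the starting values.\<close>
      have "(\<Sum>n=k-1..m. (norm (bdf_tilde k W n))\<^sup>2)
          \<le> (\<Sum>n\<in>insert (k - 1) {k..m}. (norm (bdf_tilde k W n))\<^sup>2)"
        by (intro sum_mono2) auto
      also have "\<dots> = (norm (bdf_tilde k W (k - 1)))\<^sup>2 + (\<Sum>n=k..m. (norm (bdf_tilde k W n))\<^sup>2)"
        using k by (subst sum.insert) auto
      finally show ?thesis
        using bdf_tilde_l2_stability[OF k, of W m] 1 2 3
        unfolding P_def by (simp only: distrib_right mult.assoc) argo
    qed
    define q where "q n = norm (bdf_remainder k B u n)" for n
    \<comment> \<open>The remainder at n involves second differences at n, n - 1 and n - 2; each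
      shifted sum of squares is at most \<open>P * s\<^sup>2\<close>, hence the factor 3.\<close>
    have q_sum: "(\<Sum>n=k..m. q n) \<le> 72 * c * (3 * P) * s\<^sup>2" for m
    proof -
      have sh: "(\<Sum>n=k..m. (norm (W (n - j)))\<^sup>2) \<le> P * s\<^sup>2" if "j \<le> k" for j
      proof -
        have "(\<Sum>n=k..m. (norm (W (n - j)))\<^sup>2) \<le> (\<Sum>n=k-j..m. (norm (W n))\<^sup>2)"
          using that by (intro sum_shift_le) auto
        also have "\<dots> \<le> (\<Sum>n=0..m. (norm (W n))\<^sup>2)" by (intro sum_mono2) auto
        finally show ?thesis using W_sum[of m] by linarith
      qed
      have "(\<Sum>n=k..m. q n) \<le> (\<Sum>n=k..m. 72 * c * ((norm (W (n - 0)))\<^sup>2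
          + (norm (W (n - 1)))\<^sup>2 + (norm (W (n - 2)))\<^sup>2))"
        unfolding q_def W_def diff_zero
        by (intro sum_mono norm_bdf_remainder_bdiff2_le bilinear_B symmetric_B c_nonneg norm_B_le k)
      also have "\<dots> = 72 * c * ((\<Sum>n=k..m. (norm (W (n - 0)))\<^sup>2)
          + (\<Sum>n=k..m. (norm (W (n - 1)))\<^sup>2) + (\<Sum>n=k..m. (norm (W (n - 2)))\<^sup>2))"
        by (simp add: sum_distrib_left[symmetric] sum.distrib del: diff_zero)
      also have "\<dots> \<le> 72 * c * (P * s\<^sup>2 + P * s\<^sup>2 + P * s\<^sup>2)"
        using c_nonneg k by (intro mult_left_mono add_mono sh) auto
      finally show ?thesis by (simp add: algebra_simps)
    qed
    \<comment> \<open>Telescoping from k - 1, where only starting values enter, each step adds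
      exactly one remainder.\<close>
    have tilde_b: "norm (bdf_tilde k ?b n) \<le> A * (K * s\<^sup>2) + (\<Sum>m=k..n. q m)" if "k - 1 \<le> n" for n
      using that
    proof (induction n rule: dec_induct)
      case base
      have "norm (bdf_tilde k ?b (k - 1)) \<le> A * (K * s\<^sup>2)"
        unfolding A_def using start(3) by (intro norm_bdf_tilde_le)
      then show ?case using k by simp
    next
      case (step n)
      have n: "k \<le> Suc n" using step.hyps by simp
      have "bdf_tilde k ?b (Suc n) = bdf_remainder k B u (Suc n) + bdf_tilde k ?b n"
        using bdf_tilde_bdiff_constraint[OF \<open>\<And>n. k \<le> n \<Longrightarrow> step k s u n\<close>[OF n] s, of z]
        by (simp add: bdf_tilde_bdiff bdiff_def algebra_simps)
      then have "norm (bdf_tilde k ?b (Suc n)) \<le> q (Suc n) + norm (bdf_tilde k ?b n)"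
        unfolding q_def by (metis norm_triangle_ineq)
      with step.IH n show ?case by simp
    qed
    have "norm (?b N) \<le> K * s\<^sup>2 + 11 * (A * (K * s\<^sup>2) + 72 * c * (3 * P) * s\<^sup>2)"
    proof (rule bdf_tilde_sup_stability[OF k])
      show "norm (?b i) \<le> K * s\<^sup>2" if "i < k" for i
        using start(3)[of i] that by simp
      show "norm (bdf_tilde k ?b n) \<le> A * (K * s\<^sup>2) + 72 * c * (3 * P) * s\<^sup>2" if "k - 1 \<le> n" for n
        using tilde_b[OF that] q_sum[of n] by linarith
    qed
    then show ?thesis by (simp add: C_def algebra_simps)
  qed
  moreover have "0 \<le> C"
    using K c_nonneg \<open>0 \<le> A\<close> \<open>0 \<le> P\<close> by (simp add: C_def)
  ultimately show ?thesis by blast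
qed

end

theorem theorem5p4:
  fixes \<Omega> \<Gamma>\<^sub>D :: "(real^'d) set"
    and \<iota>\<^sub>U :: "'u::{real_inner, complete_space} \<Rightarrow> real^'d \<Rightarrow> real^'m"
    and \<iota>\<^sub>Z :: "'z::real_normed_vector \<Rightarrow> real^'d \<Rightarrow> 'e::euclidean_space"
    and \<tau> :: "'u \<Rightarrow> 'y::real_normed_vector" and g :: 'y
    and U\<^sub>D U\<^sub>0 :: "'u set"
    and B :: "'u \<Rightarrow> 'u \<Rightarrow> 'z" and u\<^sub>c :: 'z and c\<^sub>Z :: real
    and M :: "'u \<Rightarrow> 'u \<Rightarrow> real" and C\<^sub>1 C\<^sub>2 :: real
    and k :: nat and \<alpha> :: real and u\<^sub>0 :: 'u
  assumes "bounded_lipschitz_domain \<Omega>" and "\<Gamma>\<^sub>D \<subseteq> frontier \<Omega>"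
    and "function_space_on \<Omega> \<iota>\<^sub>U" and "continuously_embedded_in_H1 \<Omega> \<iota>\<^sub>U"
    and "trace_operator \<Omega> \<Gamma>\<^sub>D \<iota>\<^sub>U \<tau>"
    and "U\<^sub>D = dirichlet_set \<tau> g" and "U\<^sub>0 = dirichlet_set \<tau> 0"
    and "function_space_on \<Omega> \<iota>\<^sub>Z"
    and "bilinear B" and "symmetric_form B"
    and "\<And>v. norm (B v v) \<le> c\<^sub>Z * (norm v)\<^sup>2"
    and "bilinear M" and "symmetric_form M"
    and "C\<^sub>1 > 0" and "C\<^sub>2 > 0"
    and "\<And>v. M v v \<ge> C\<^sub>1 * (norm v)\<^sup>2"
    and "\<And>v w. M v w \<le> C\<^sub>2 * norm v * norm w"
    and "2 \<le> k" and "k \<le> 4" and "\<alpha> \<ge> 3"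
    and "u\<^sub>0 \<in> admissible_set U\<^sub>D B u\<^sub>c"
  shows "\<exists>C>0. \<forall>s>0. \<forall>u.
           bdf_accelerated_sequence k \<alpha> s M (tangent_space U\<^sub>0 B) u\<^sub>0 u \<longrightarrow>
           (\<forall>N\<ge>1. norm (B (u N) (u N) - u\<^sub>c) \<le> C * s\<^sup>2)"
proof -
  \<comment> \<open>No sign is assumed for \<open>c\<^sub>Z\<close>, whereas the locale asks for a
    nonnegative growth constant.\<close>
  interpret bdf_setting M B "max c\<^sub>Z 0" C\<^sub>1 C\<^sub>2 \<alpha> U\<^sub>0
  proof
    show "norm (B v v) \<le> max c\<^sub>Z 0 * (norm v)\<^sup>2" for v
      using assms(11)[of v] by (rule order_trans) (intro mult_right_mono, auto)
    show "M v v \<le> C\<^sub>2 * (norm v)\<^sup>2" for v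
      using assms(17)[of v v] by (simp add: power2_eq_square mult.assoc)
  qed (use assms in auto)
  have "B u\<^sub>0 u\<^sub>0 = u\<^sub>c"
    using assms by (simp add: admissible_set_def)
  from constraint_violation_le[OF this assms(18,19)] obtain C where C: "0 \<le> C"
    "\<And>s u N. 0 < s \<Longrightarrow> bdf_accelerated_sequence k \<alpha> s M (tangent_space U\<^sub>0 B) u\<^sub>0 u \<Longrightarrow>
      norm (B (u N) (u N) - u\<^sub>c) \<le> C * s\<^sup>2"
    by blast
  show ?thesis
  \<comment> \<open>Adding 1 turns the nonnegative constant into a positive one.\<close>
  proof (intro exI[of _ "C + 1"] conjI allI impI)
    fix s :: real and u N
    assume "0 < s" "bdf_accelerated_sequence k \<alpha> s M (tangent_space U\<^sub>0 B) u\<^sub>0 u"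
    then have "norm (B (u N) (u N) - u\<^sub>c) \<le> C * s\<^sup>2" by (rule C(2))
    also have "\<dots> \<le> (C + 1) * s\<^sup>2" by (intro mult_right_mono) auto
    finally show "norm (B (u N) (u N) - u\<^sub>c) \<le> (C + 1) * s\<^sup>2" .
  qed (use C(1) in simp)
qed

end
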